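(* Let $p(D)\in\mathbb{C}[D]$ be a nonzero polynomial, let $k_0\ge 0$ be an integer, let $\mu\in\mathbb{C}$, and let $f(x)=x^{k_0}e^{\mu x}$. Then there exists a finite-dimensional vector subspace $F\subset C^\infty(\mathbb{R})$ in which the equation $p(D)y=f$ has a unique solution, i.e. there is exactly one $y\in F$ with $p(D)y=f$.
   Context: $C^\infty(\mathbb{R})$ is the complex vector space of infinitely differentiable functions $\mathbb{R}\to\mathbb{C}$, and $D=\frac{d}{dx}$. A polynomial $p(D)\in\mathbb{C}[D]$ acts on $C^\infty(\mathbb{R})$ as the differential operator $p\left(\frac{d}{dx}\right)$. *)

theory Defs
  imports
    "HOL-Analysis.Analysis"
    "HOL-Computational_Algebra.Polynomial"
    "HOL-Library.Function_Algebras"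
begin

definition scale_fun :: "complex \<Rightarrow> (real \<Rightarrow> complex) \<Rightarrow> real \<Rightarrow> complex" where
  "scale_fun c f = (\<lambda>x. c * f x)"

global_interpretation cfun: vector_space scale_fun
  by unfold_locales (simp_all add: scale_fun_def fun_eq_iff algebra_simps)

definition D :: "(real \<Rightarrow> complex) \<Rightarrow> real \<Rightarrow> complex" where
  "D f = (\<lambda>x. vector_derivative f (at x))"

(* vector_derivative is total, so differentiability of every iterate has to be required. *)
definition smooth_functions :: "(real \<Rightarrow> complex) set" where
  "smooth_functions = {f. \<forall>n x. (D ^^ n) f differentiable at x}"

(* The action of p(D); meaningful only on smooth_functions, see above. *)
definition diff_op :: "complex poly \<Rightarrow> (real \<Rightarrow> complex) \<Rightarrow> real \<Rightarrow> complex" where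
  "diff_op p y = (\<Sum>i\<le>degree p. scale_fun (coeff p i) ((D ^^ i) y))"

(* The locale finite_dimensional_vector_space and the function dim do not help here:
   the ambient type is infinite-dimensional, and dim is 0 on infinite-dimensional subspaces. *)
definition finite_dim_subspace :: "(real \<Rightarrow> complex) set \<Rightarrow> bool" where
  "finite_dim_subspace F \<longleftrightarrow> cfun.subspace F \<and> (\<exists>B. finite B \<and> cfun.span B = F)"

end

theory Submission
  imports Defs "HOL-Computational_Algebra.Fundamental_Theorem_Algebra"
begin

text \<open>
  On functions \<open>q(x) e\<^sup>\<mu>\<^sup>x\<close> with \<open>q\<close> a polynomial, \<open>D\<close> acts as \<open>q \<mapsto> q' + \<mu> q\<close>. Splitting \<open>p\<close> into
  linear factors, \<open>p(D)\<close> becomes a composition of operators \<open>q \<mapsto> q' + c q\<close>, each surjective on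
  polynomials; so there is a solution \<open>y\<close> of this form. As \<open>f \<noteq> 0\<close>, the equation \<open>p(D) (c y) = f\<close>
  forces \<open>c = 1\<close>, and the line spanned by \<open>y\<close> serves as \<open>F\<close>.
\<close>

definition twisted_pderiv :: "complex \<Rightarrow> complex poly \<Rightarrow> complex poly" where
  "twisted_pderiv \<mu> q = pderiv q + smult \<mu> q"

definition twisted_op :: "complex \<Rightarrow> complex poly \<Rightarrow> complex poly \<Rightarrow> complex poly" where
  "twisted_op \<mu> p q = (\<Sum>i\<le>degree p. smult (coeff p i) ((twisted_pderiv \<mu> ^^ i) q))"

definition exp_poly :: "complex \<Rightarrow> complex poly \<Rightarrow> real \<Rightarrow> complex" where
  "exp_poly \<mu> q = (\<lambda>x. poly q (of_real x) * exp (\<mu> * of_real x))"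

lemma smult_sum_right: "smult c (\<Sum>i\<in>A. f i) = (\<Sum>i\<in>A. smult c (f i))"
  by (induction A rule: infinite_finite_induct) (simp_all add: smult_add_right)

lemma funpow_twisted_pderiv_add:
  "(twisted_pderiv \<mu> ^^ i) (q + r) = (twisted_pderiv \<mu> ^^ i) q + (twisted_pderiv \<mu> ^^ i) r"
  by (induction i) (simp_all add: twisted_pderiv_def pderiv_add smult_add_right)

lemma funpow_twisted_pderiv_smult:
  "(twisted_pderiv \<mu> ^^ i) (smult c q) = smult c ((twisted_pderiv \<mu> ^^ i) q)"
  by (induction i) (simp_all add: twisted_pderiv_def pderiv_smult smult_add_right mult.commute)

lemma twisted_op_add_right: "twisted_op \<mu> p (q + r) = twisted_op \<mu> p q + twisted_op \<mu> p r"
  by (simp add: twisted_op_def funpow_twisted_pderiv_add smult_add_right sum.distrib)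

lemma twisted_op_smult_right: "twisted_op \<mu> p (smult c q) = smult c (twisted_op \<mu> p q)"
  by (simp add: twisted_op_def funpow_twisted_pderiv_smult smult_sum_right mult.commute)

text \<open>The added coefficients vanish. A freely chosen upper bound lets operators of polynomials
  of different degrees be compared over one common range.\<close>

lemma twisted_op_eq_sum:
  assumes "degree p \<le> n"
  shows "twisted_op \<mu> p q = (\<Sum>i\<le>n. smult (coeff p i) ((twisted_pderiv \<mu> ^^ i) q))"
  unfolding twisted_op_def
  by (rule sum.mono_neutral_left) (use assms in \<open>auto simp: coeff_eq_0\<close>)

lemma twisted_op_pCons: "twisted_op \<mu> (pCons c p) q = smult c q + twisted_op \<mu> p (twisted_pderiv \<mu> q)"
proof -
  have "twisted_op \<mu> (pCons c p) q =
      (\<Sum>i\<le>Suc (degree p). smult (coeff (pCons c p) i) ((twisted_pderiv \<mu> ^^ i) q))"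
    by (rule twisted_op_eq_sum) (rule degree_pCons_le)
  \<comment> \<open>The term i = 0 splits off. In the shifted rest the innermost application is
    peeled from each power, so one \<open>twisted_pderiv\<close> lands on \<open>q\<close>.\<close>
  also have "\<dots> = smult c q + twisted_op \<mu> p (twisted_pderiv \<mu> q)"
    unfolding sum.atMost_Suc_shift twisted_op_def
    by (simp add: funpow_Suc_right del: funpow.simps)
  finally show ?thesis .
qed

lemma twisted_op_add_left: "twisted_op \<mu> (p + p') q = twisted_op \<mu> p q + twisted_op \<mu> p' q"
proof -
  let ?n = "max (degree p) (degree p')"
  have "degree (p + p') \<le> ?n" by (rule degree_add_le_max)
  then show ?thesis
    by (simp add: twisted_op_eq_sum[of _ ?n] smult_add_left sum.distrib)
qed

lemma twisted_op_smult_left: "twisted_op \<mu> (smult c p) q = smult c (twisted_op \<mu> p q)"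
  by (simp add: twisted_op_eq_sum[of _ "degree p"] degree_smult_le smult_sum_right)

text \<open>Conjugation by the exponential turns D - a into q' + (\<mu> - a) q. This factor acts
  first, so that linear factors can be stripped from p one at a time.\<close>

lemma twisted_op_linear_mult:
  "twisted_op \<mu> ([:- a, 1:] * p) q = twisted_op \<mu> p (pderiv q + smult (\<mu> - a) q)"
proof -
  have "[:- a, 1:] * p = smult (- a) p + pCons 0 p"
    by simp
  then have "twisted_op \<mu> ([:- a, 1:] * p) q =
      twisted_op \<mu> p (smult (- a) q) + twisted_op \<mu> p (twisted_pderiv \<mu> q)"
    by (simp only: twisted_op_add_left twisted_op_smult_left twisted_op_pCons
        twisted_op_smult_right smult_0_left add_0_left)
  then show ?thesis
    by (simp add: twisted_op_add_right[symmetric] twisted_pderiv_def algebra_simps smult_diff_left)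
qed

text \<open>Integrate monomial by monomial; in characteristic 0 the divisors i + 1 are
  nonzero.\<close>

lemma pderiv_surj: "\<exists>q. pderiv q = (r :: complex poly)"
proof
  have "pderiv (\<Sum>i\<le>degree r. monom (coeff r i / of_nat (Suc i)) (Suc i)) =
      (\<Sum>i\<le>degree r. monom (coeff r i) i)"
    by (simp add: higher_pderiv_sum[of 1, simplified] pderiv_monom del: of_nat_Suc)
  then show "pderiv (\<Sum>i\<le>degree r. monom (coeff r i / of_nat (Suc i)) (Suc i)) = r"
    by (simp add: poly_as_sum_of_monoms)
qed

text \<open>The case c = 0 is resonance, met when the root a equals \<mu>; there one integrates.
  Otherwise differentiating the right-hand side lowers its degree until it is constant.\<close>

lemma pderiv_plus_smult_surj: "\<exists>q. pderiv q + smult c q = (r :: complex poly)"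
proof (cases "c = 0")
  case True
  then show ?thesis using pderiv_surj by simp
next
  case False
  show ?thesis
  proof (induction "degree r" arbitrary: r rule: less_induct)
    case less
    show ?case
    proof (cases "degree r = 0")
      case True
      then have "pderiv (smult (1 / c) r) + smult c (smult (1 / c) r) = r"
        using False by (simp add: pderiv_smult pderiv_eq_0_iff)
      then show ?thesis by blast
    next
      case pos: False
      then obtain q where "pderiv q + smult c q = pderiv r"
        using less[of "pderiv r"] by (auto simp: degree_pderiv)
      \<comment> \<open>The witness comes from solving u' + c u = r for u = (r - u') / c:
        differentiating the equation shows that u' solves it for r', and \<open>q\<close> is such a
        solution.\<close>
      then have "pderiv (smult (1 / c) (r - q)) + smult c (smult (1 / c) (r - q)) = r"
        using False
        by (simp add: pderiv_smult pderiv_diff smult_add_right[symmetric] smult_diff_right[symmetric]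
            flip: eq_diff_eq)
      then show ?thesis by blast
    qed
  qed
qed

lemma twisted_op_surj:
  assumes "p \<noteq> 0"
  shows "\<exists>q. twisted_op \<mu> p q = r"
  using assms
proof (induction "degree p" arbitrary: p r)
  case 0
  then obtain a where "p = [:a:]" "a \<noteq> 0"
    by (metis degree_eq_zeroE pCons_0_0)
  then have "twisted_op \<mu> p (smult (1 / a) r) = r"
    by (simp add: twisted_op_def)
  then show ?case by blast
next
  case (Suc n)
  then obtain a where "poly p a = 0"
    using fundamental_theorem_of_algebra by (metis constant_degree nat.distinct(1))
  then obtain p' where p: "p = [:- a, 1:] * p'"
    by (metis poly_eq_0_iff_dvd dvdE)
  with Suc.prems have "p' \<noteq> 0" by auto
  with p Suc.hyps(2) have "n = degree p'"
    by (subst (asm) p, subst (asm) degree_mult_eq) auto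
  \<comment> \<open>The equation is solved from the outside in: first for the cofactor
    \<open>p'\<close>, then for the linear factor with the result \<open>s\<close> on the
    right.\<close>
  with Suc.hyps(1) \<open>p' \<noteq> 0\<close> obtain s where "twisted_op \<mu> p' s = r" by blast
  moreover obtain q where "pderiv q + smult (\<mu> - a) q = s"
    using pderiv_plus_smult_surj by blast
  ultimately have "twisted_op \<mu> p q = r"
    unfolding p twisted_op_linear_mult by simp
  then show ?case by blast
qed

lemma exp_poly_has_vector_derivative:
  "(exp_poly \<mu> q has_vector_derivative exp_poly \<mu> (twisted_pderiv \<mu> q) x) (at x)"
proof -
  \<comment> \<open>Differentiate over the complex plane, where the product and chain rules apply
    directly, then restrict to the real line.\<close>
  have "((\<lambda>z. poly q z * exp (\<mu> * z)) has_field_derivative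
      poly (twisted_pderiv \<mu> q) (of_real x) * exp (\<mu> * of_real x)) (at (of_real x))"
    by (auto intro!: derivative_eq_intros simp: twisted_pderiv_def algebra_simps)
  then show ?thesis
    unfolding exp_poly_def by (rule has_vector_derivative_real_field)
qed

lemma D_funpow_exp_poly: "(D ^^ n) (exp_poly \<mu> q) = exp_poly \<mu> ((twisted_pderiv \<mu> ^^ n) q)"
  by (induction n) (auto simp: D_def vector_derivative_at[OF exp_poly_has_vector_derivative])

lemma exp_poly_smooth: "exp_poly \<mu> q \<in> smooth_functions"
  unfolding smooth_functions_def
  by (auto simp: D_funpow_exp_poly intro: differentiableI_vector exp_poly_has_vector_derivative)

lemma diff_op_exp_poly: "diff_op p (exp_poly \<mu> q) = exp_poly \<mu> (twisted_op \<mu> p q)"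
proof -
  \<comment> \<open>Linearity of \<open>exp_poly \<mu>\<close>, stated for any finite index set so
    that induction applies.\<close>
  have "(\<Sum>i\<in>A. scale_fun (c i) (exp_poly \<mu> (r i))) = exp_poly \<mu> (\<Sum>i\<in>A. smult (c i) (r i))"
    if "finite A" for A :: "nat set" and c r
    using that by induction (auto simp: exp_poly_def scale_fun_def fun_eq_iff algebra_simps)
  then show ?thesis
    by (simp add: diff_op_def D_funpow_exp_poly twisted_op_def)
qed

lemma scale_fun_exp_poly: "scale_fun c (exp_poly \<mu> q) = exp_poly \<mu> (smult c q)"
  by (simp add: scale_fun_def exp_poly_def mult.assoc)

theorem theorem4p3:
  fixes p :: "complex poly" and k0 :: nat and \<mu> :: complex and f :: "real \<Rightarrow> complex"
  assumes "p \<noteq> 0"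
    and "f = (\<lambda>x. of_real x ^ k0 * exp (\<mu> * of_real x))"
  shows "\<exists>F. F \<subseteq> smooth_functions \<and> finite_dim_subspace F \<and> (\<exists>!y. y \<in> F \<and> diff_op p y = f)"
proof -
  have f: "f = exp_poly \<mu> (monom 1 k0)"
    by (simp add: assms(2) exp_poly_def poly_monom)
  obtain q where q: "twisted_op \<mu> p q = monom 1 k0"
    using twisted_op_surj[OF assms(1)] by blast
  let ?y = "exp_poly \<mu> q"
  let ?F = "cfun.span {?y}"
  have F: "?F = range (\<lambda>c. scale_fun c ?y)"
    by (rule cfun.span_singleton)
  have "?F \<subseteq> smooth_functions"
    unfolding F by (auto simp: scale_fun_exp_poly exp_poly_smooth)
  moreover have "finite_dim_subspace ?F"
    unfolding finite_dim_subspace_def using cfun.subspace_span by blast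
  moreover have "\<exists>!y. y \<in> ?F \<and> diff_op p y = f"
  proof (rule ex1I[of _ ?y])
    show "?y \<in> ?F \<and> diff_op p ?y = f"
      by (simp add: cfun.span_base diff_op_exp_poly q f)
  next
    fix z assume z: "z \<in> ?F \<and> diff_op p z = f"
    then obtain c where c: "z = scale_fun c ?y" unfolding F by blast
    \<comment> \<open>By linearity p(D) maps c y to c f.\<close>
    have "scale_fun c f = f"
      using z by (simp add: c scale_fun_exp_poly diff_op_exp_poly twisted_op_smult_right q f)
    \<comment> \<open>The point 1 serves every k0: there f equals exp \<mu>, which is nonzero,
      whereas at 0 f vanishes once k0 > 0.\<close>
    then have "c * f 1 = f 1"
      by (metis scale_fun_def)
    then have "c = 1"
      by (simp add: assms(2))
    then show "z = ?y" by (simp add: c)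
  qed
  ultimately show ?thesis by blast
qed

end
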